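(* Let $f:[0,\infty)\to\mathbb R$. The following assertions hold. 1. The entrywise map induced by $f$ is Loewner convex on $\mathcal C_{\min,n}$ for every $n\ge1$ (equivalently, on $\mathcal C_{\max,n}$ for every $n\ge1$) if and only if $f\in C^1([0,\infty))$ and both $f$ and $f'$ are convex on $[0,\infty)$. 2. The entrywise map induced by $f$ is Loewner concave on $\mathcal C_{\min,n}$ for every $n\ge1$ (equivalently, on $\mathcal C_{\max,n}$ for every $n\ge1$) if and only if $f\in C^1([0,\infty))$ and both $f$ and $f'$ are concave on $[0,\infty)$. In either assertion, it is enough to assume the corresponding Loewner convexity (respectively concavity) property only in dimension $n=2$.
   Context: For $x=(x_1,\ldots,x_n)\in\mathbb R^n$, define the $n\times n$ real symmetric matrices $A_{\min}(x)=\bigl(x_{\min(i,j)}\bigr)_{i,j=1}^n$ and $A_{\max}(x)=\bigl(x_{\max(i,j)}\bigr)_{i,j=1}^n$. Set $\mathcal C_{\min,n}=\{A_{\min}(x):0\le x_1\le x_2\le\cdots\le x_n\}$ and $\mathcal C_{\max,n}=\{A_{\max}(x):x_1\ge x_2\ge\cdots\ge x_n\ge0\}$; both are convex cones. For a matrix $A=(a_{ij})$ with entries in $[0,\infty)$, $f[A]=(f(a_{ij}))$; the entrywise map induced by $f$ is $A\mapsto f[A]$. For real symmetric matrices, $A\preceq B$ means that $B-A$ is positive semidefinite. Comparable-pairs convention: the entrywise map induced by $f$ is called Loewner convex on $\mathcal C$ (where $\mathcal C=\mathcal C_{\min,n}$ or $\mathcal C_{\max,n}$) if $f[\lambda A+(1-\lambda)B]\preceq\lambda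 f[A]+(1-\lambda)f[B]$ whenever $A,B\in\mathcal C$, $B\preceq A$ and $0\le\lambda\le1$. It is called Loewner concave on $\mathcal C$ if the reverse inequality $\lambda f[A]+(1-\lambda)f[B]\preceq f[\lambda A+(1-\lambda)B]$ holds for all such $A,B,\lambda$. $f\in C^1([0,\infty))$ means that $f$ is differentiable on $[0,\infty)$ (with the right-hand derivative at $0$) and $f'$ is continuous on $[0,\infty)$. *)

theory Defs
  imports "HOL-Analysis.Convex" "Jordan_Normal_Form.Matrix"
begin

(* Matrices and vectors are indexed from 0, so that the entries x_1, ..., x_n
   are x $ 0, ..., x $ (n - 1). *)

definition A_min :: "real vec \<Rightarrow> real mat" where
  "A_min x = mat (dim_vec x) (dim_vec x) (\<lambda>(i, j). x $ (min i j))"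

definition A_max :: "real vec \<Rightarrow> real mat" where
  "A_max x = mat (dim_vec x) (dim_vec x) (\<lambda>(i, j). x $ (max i j))"

definition C_min :: "nat \<Rightarrow> real mat set" where
  "C_min n = {A_min x | x. x \<in> carrier_vec n \<and>
     (\<forall>i<n. 0 \<le> x $ i) \<and> (\<forall>i j. i \<le> j \<and> j < n \<longrightarrow> x $ i \<le> x $ j)}"

definition C_max :: "nat \<Rightarrow> real mat set" where
  "C_max n = {A_max x | x. x \<in> carrier_vec n \<and>
     (\<forall>i<n. 0 \<le> x $ i) \<and> (\<forall>i j. i \<le> j \<and> j < n \<longrightarrow> x $ i \<ge> x $ j)}"

definition sym_mat :: "real mat \<Rightarrow> bool" where
  "sym_mat A \<longleftrightarrow> square_mat A \<and> transpose_mat A = A"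

definition psd_mat :: "real mat \<Rightarrow> bool" where
  "psd_mat A \<longleftrightarrow> sym_mat A \<and> (\<forall>v \<in> carrier_vec (dim_row A). 0 \<le> scalar_prod v (A *\<^sub>v v))"

(* The Loewner order; the order \<le> that the library puts on matrices is entrywise. *)
definition loewner_le :: "real mat \<Rightarrow> real mat \<Rightarrow> bool" (infix "\<preceq>\<^sub>L" 50) where
  "A \<preceq>\<^sub>L B \<longleftrightarrow> sym_mat A \<and> sym_mat B \<and> dim_row A = dim_row B \<and> psd_mat (B - A)"

(* Convexity and concavity along comparable pairs only. A function on [0, \<infinity>) is a
   total function real \<Rightarrow> real of which only the values on {0..} matter. *)

definition loewner_convex_on :: "real mat set \<Rightarrow> (real \<Rightarrow> real) \<Rightarrow> bool" where
  "loewner_convex_on C f \<longleftrightarrow>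
     (\<forall>A \<in> C. \<forall>B \<in> C. \<forall>l::real. B \<preceq>\<^sub>L A \<and> 0 \<le> l \<and> l \<le> 1 \<longrightarrow>
        map_mat f (l \<cdot>\<^sub>m A + (1 - l) \<cdot>\<^sub>m B) \<preceq>\<^sub>L l \<cdot>\<^sub>m map_mat f A + (1 - l) \<cdot>\<^sub>m map_mat f B)"

definition loewner_concave_on :: "real mat set \<Rightarrow> (real \<Rightarrow> real) \<Rightarrow> bool" where
  "loewner_concave_on C f \<longleftrightarrow>
     (\<forall>A \<in> C. \<forall>B \<in> C. \<forall>l::real. B \<preceq>\<^sub>L A \<and> 0 \<le> l \<and> l \<le> 1 \<longrightarrow>
        l \<cdot>\<^sub>m map_mat f A + (1 - l) \<cdot>\<^sub>m map_mat f B \<preceq>\<^sub>L map_mat f (l \<cdot>\<^sub>m A + (1 - l) \<cdot>\<^sub>m B))"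

(* f is C^1 on [0, \<infinity>) with derivative f', one-sided at 0;
   this determines f' uniquely on [0, \<infinity>). *)
definition C1_halfline_with_deriv :: "(real \<Rightarrow> real) \<Rightarrow> (real \<Rightarrow> real) \<Rightarrow> bool" where
  "C1_halfline_with_deriv f f' \<longleftrightarrow>
     (\<forall>x \<in> {0..}. (f has_real_derivative f' x) (at x within {0..})) \<and> continuous_on {0..} f'"

end

theory Submission
  imports "HOL-Analysis.Convex_Euclidean_Space" "HOL-Analysis.Derivative" Defs
begin

text \<open>
  Both cones consist of matrices whose entry in position (i, j) is one of the two numbers
  \<open>x i\<close>, \<open>x j\<close>, namely the smaller one. The kernel \<open>min (z i) (z j)\<close> of a nonnegative \<open>z\<close> is
  positive semidefinite (\<open>min_kernel_nonneg\<close>), and testing with \<open>e\<^sub>i\<close> and \<open>e\<^sub>i - e\<^sub>j\<close> gives the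
  converse: a matrix of this pattern is positive semidefinite exactly if it belongs to the cone
  (\<open>psd_sel_mat_iff\<close>). Entrywise maps and convex combinations preserve the pattern, so the
  Loewner inequality is an assertion about the Jensen gap
  \[ D_l(a, b) = l f(a) + (1 - l) f(b) - f(l a + (1 - l) b), \]
  namely that \<open>D\<^sub>l(a, b)\<close> is nonnegative and does not decrease when \<open>b \<ge> 0\<close> and \<open>a - b \<ge> 0\<close>
  both grow. Only two indices are compared at a time, which is why dimension 2 decides everything.

  If \<open>f'\<close> exists and both \<open>f\<close> and \<open>f'\<close> are convex, the gap has nonnegative derivatives: in the
  direction of \<open>a - b\<close> because \<open>f'\<close> increases, and along a translation of \<open>a\<close> and \<open>b\<close> because
  \<open>f'\<close> satisfies Jensen's inequality (\<open>C1_imp_gap_monotone\<close>).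

  Conversely, nonnegativity of the gap is convexity of \<open>f\<close>, and its growth under translation by
  \<open>d\<close> says that the difference quotient \<open>b \<mapsto> (f (b + d) - f b) / d\<close> is convex for every \<open>d > 0\<close>.
  As \<open>d\<close> tends to 0 these quotients decrease to the right-hand derivative \<open>p\<close>, which is therefore
  convex as well, and increasing, hence continuous. The slope of \<open>f\<close> on \<open>[x, y]\<close> lies
  between \<open>p x\<close> and \<open>p y\<close>, and continuity of \<open>p\<close> turns this into two-sided differentiability
  with \<open>f' = p\<close> (\<open>gap_monotone_imp_C1\<close>). The concave case is the convex case of \<open>- f\<close>.
\<close>

section \<open>Matrices whose entries are selected from a vector\<close>

text \<open>A common description of \<open>min\<close> and \<open>max\<close> that lets the two cones be treated at once.\<close>

definition selector :: "(nat \<Rightarrow> nat \<Rightarrow> nat) \<Rightarrow> bool" where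
  "selector s \<longleftrightarrow> (\<forall>i j. s i j = s j i \<and> (s i j = i \<or> s i j = j))"

definition sel_mat :: "(nat \<Rightarrow> nat \<Rightarrow> nat) \<Rightarrow> nat \<Rightarrow> (nat \<Rightarrow> real) \<Rightarrow> real mat" where
  "sel_mat s n x = mat n n (\<lambda>(i, j). x (s i j))"

text \<open>Monotonicity in the direction of the selector: for \<open>s = min\<close> this makes \<open>z\<close> nondecreasing, for
  \<open>s = max\<close> nonincreasing. For a symmetric selector it forces
  \<open>z (s i j) = min (z i) (z j)\<close>.\<close>

definition admissible :: "(nat \<Rightarrow> nat \<Rightarrow> nat) \<Rightarrow> nat \<Rightarrow> (nat \<Rightarrow> real) \<Rightarrow> bool" where
  "admissible s n z \<longleftrightarrow> (\<forall>i<n. 0 \<le> z i) \<and> (\<forall>i<n. \<forall>j<n. z (s i j) \<le> z i)"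

definition sel_cone :: "(nat \<Rightarrow> nat \<Rightarrow> nat) \<Rightarrow> nat \<Rightarrow> real mat set" where
  "sel_cone s n = {sel_mat s n x | x. admissible s n x}"

lemma selector_min: "selector min" and selector_max: "selector max"
  by (auto simp: selector_def min_def max_def)

lemma selector_less: "selector s \<Longrightarrow> i < n \<Longrightarrow> j < n \<Longrightarrow> s i j < n"
  unfolding selector_def by metis

lemma C_min_eq_sel_cone: "C_min n = sel_cone min n"
proof (intro equalityI subsetI)
  fix A assume "A \<in> C_min n"
  then obtain x where x: "A = A_min x" "x \<in> carrier_vec n" "\<forall>i<n. 0 \<le> vec_index x i"
    "\<forall>i j. i \<le> j \<and> j < n \<longrightarrow> vec_index x i \<le> vec_index x j"
    unfolding C_min_def by auto
  then have "A = sel_mat min n (vec_index x)" "admissible min n (vec_index x)"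
    by (auto simp: A_min_def sel_mat_def admissible_def)
  then show "A \<in> sel_cone min n" unfolding sel_cone_def by blast
next
  fix A assume "A \<in> sel_cone min n"
  then obtain x where x: "A = sel_mat min n x" "admissible min n x"
    unfolding sel_cone_def by blast
  have "x i \<le> x j" if "i \<le> j" "j < n" for i j
  proof -
    have "i < n" "min j i = i" using that by auto
    then show ?thesis using x(2) that(2) unfolding admissible_def by metis
  qed
  with x have "A = A_min (vec n x) \<and> vec n x \<in> carrier_vec n \<and> (\<forall>i<n. 0 \<le> vec_index (vec n x) i)
    \<and> (\<forall>i j. i \<le> j \<and> j < n \<longrightarrow> vec_index (vec n x) i \<le> vec_index (vec n x) j)"
    by (auto simp: A_min_def sel_mat_def admissible_def)
  then show "A \<in> C_min n" unfolding C_min_def by (intro CollectI exI)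
qed

lemma C_max_eq_sel_cone: "C_max n = sel_cone max n"
proof (intro equalityI subsetI)
  fix A assume "A \<in> C_max n"
  then obtain x where x: "A = A_max x" "x \<in> carrier_vec n" "\<forall>i<n. 0 \<le> vec_index x i"
    "\<forall>i j. i \<le> j \<and> j < n \<longrightarrow> vec_index x i \<ge> vec_index x j"
    unfolding C_max_def by auto
  then have "A = sel_mat max n (vec_index x)" "admissible max n (vec_index x)"
    by (auto simp: A_max_def sel_mat_def admissible_def)
  then show "A \<in> sel_cone max n" unfolding sel_cone_def by blast
next
  fix A assume "A \<in> sel_cone max n"
  then obtain x where x: "A = sel_mat max n x" "admissible max n x"
    unfolding sel_cone_def by blast
  have "x i \<ge> x j" if "i \<le> j" "j < n" for i j
  proof -
    have "i < n" "max i j = j" using that by auto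
    then show ?thesis using x(2) that(2) unfolding admissible_def by metis
  qed
  with x have "A = A_max (vec n x) \<and> vec n x \<in> carrier_vec n \<and> (\<forall>i<n. 0 \<le> vec_index (vec n x) i)
    \<and> (\<forall>i j. i \<le> j \<and> j < n \<longrightarrow> vec_index (vec n x) i \<ge> vec_index (vec n x) j)"
    by (auto simp: A_max_def sel_mat_def admissible_def)
  then show "A \<in> C_max n" unfolding C_max_def by (intro CollectI exI)
qed

section \<open>Positive semidefiniteness\<close>

text \<open>Subtracting the smallest value \<open>z m\<close> from \<open>z\<close> splits off the square \<open>z m * (\<Sum>i\<in>S. v i)\<^sup>2\<close>.
  The remaining kernel vanishes in the row and column of \<open>m\<close> and is again a \<open>min\<close> kernel, so
  induction applies to \<open>S - {m}\<close>.\<close>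

lemma min_kernel_nonneg:
  fixes z v :: "'a \<Rightarrow> real"
  assumes "finite S" "\<forall>i\<in>S. 0 \<le> z i"
  shows "0 \<le> (\<Sum>i\<in>S. \<Sum>j\<in>S. min (z i) (z j) * (v i * v j))"
  using assms
proof (induction S arbitrary: z rule: finite_psubset_induct)
  case (psubset S)
  show ?case
  proof (cases "S = {}")
    case False
    obtain m where m: "m \<in> S" "\<forall>i\<in>S. z m \<le> z i"
      using arg_min_if_finite(1,2)[OF psubset.hyps False, of z] by (meson not_le)
    define w where "w i = z i - z m" for i
    have w: "\<forall>i\<in>S. 0 \<le> w i" "w m = 0" using m by (auto simp: w_def)
    have "0 \<le> (\<Sum>i\<in>S - {m}. \<Sum>j\<in>S - {m}. min (w i) (w j) * (v i * v j))"
      using psubset.IH[of "S - {m}" w] m(1) w(1) by auto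
    also have "\<dots> = (\<Sum>i\<in>S - {m}. \<Sum>j\<in>S. min (w i) (w j) * (v i * v j))"
      using psubset.hyps m(1) w by (intro sum.cong sum.mono_neutral_left) auto
    also have "\<dots> = (\<Sum>i\<in>S. \<Sum>j\<in>S. min (w i) (w j) * (v i * v j))"
      using psubset.hyps m(1) w by (intro sum.mono_neutral_left) auto
    finally have w_sum: "0 \<le> (\<Sum>i\<in>S. \<Sum>j\<in>S. min (w i) (w j) * (v i * v j))" .
    have "(\<Sum>i\<in>S. \<Sum>j\<in>S. min (z i) (z j) * (v i * v j))
        = (\<Sum>i\<in>S. \<Sum>j\<in>S. z m * (v i * v j) + min (w i) (w j) * (v i * v j))"
      by (intro sum.cong) (auto simp: w_def min_def algebra_simps)
    also have "\<dots> = z m * (\<Sum>i\<in>S. v i)\<^sup>2 + (\<Sum>i\<in>S. \<Sum>j\<in>S. min (w i) (w j) * (v i * v j))"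
      unfolding sum.distrib power2_eq_square sum_product by (simp only: sum_distrib_left)
    finally show ?thesis
      using w_sum m(1) psubset.prems by simp
  qed simp
qed

lemma scalar_prod_sel_mat:
  assumes "v \<in> carrier_vec n"
  shows "scalar_prod v (sel_mat s n z *\<^sub>v v)
    = (\<Sum>i<n. \<Sum>j<n. z (s i j) * (vec_index v i * vec_index v j))"
proof -
  have "vec_index v i * vec_index (sel_mat s n z *\<^sub>v v) i
      = (\<Sum>j<n. z (s i j) * (vec_index v i * vec_index v j))" if "i < n" for i
    using that assms
    by (simp add: sel_mat_def scalar_prod_def sum_distrib_left atLeast0LessThan ac_simps)
  moreover have "dim_vec (sel_mat s n z *\<^sub>v v) = n"
    by (simp add: sel_mat_def)
  ultimately show ?thesis
    by (simp add: scalar_prod_def atLeast0LessThan)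
qed

lemma sym_sel_mat: "selector s \<Longrightarrow> sym_mat (sel_mat s n z)"
  unfolding sym_mat_def sel_mat_def selector_def by (auto intro!: eq_matI)

text \<open>Necessity comes from the test vectors \<open>e\<^sub>i\<close>, with value \<open>z i\<close>, and \<open>e\<^sub>i - e\<^sub>j\<close>, with value
  \<open>z i + z j - 2 * z (s i j)\<close>. For sufficiency the entries are those of the \<open>min\<close> kernel.\<close>

lemma psd_sel_mat_iff:
  assumes "selector s"
  shows "psd_mat (sel_mat s n z) \<longleftrightarrow> admissible s n z"
proof
  assume psd: "psd_mat (sel_mat s n z)"
  have q: "0 \<le> (\<Sum>i<n. \<Sum>j<n. z (s i j) * (u i * u j))" for u
  proof -
    have "0 \<le> scalar_prod (vec n u) (sel_mat s n z *\<^sub>v vec n u)"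
      using psd unfolding psd_mat_def by (auto simp: sel_mat_def)
    then show ?thesis by (subst (asm) scalar_prod_sel_mat) auto
  qed
  have diag: "s i i = i" for i using assms unfolding selector_def by metis
  show "admissible s n z"
    unfolding admissible_def
  proof (intro conjI allI impI)
    fix i assume i: "i < n"
    have "(\<Sum>k<n. \<Sum>l<n. z (s k l) * (of_bool (k = i) * of_bool (l = i))) = z i"
      using i by (simp add: diag of_bool_def if_distrib[of "\<lambda>x. _ * x"] if_distrib[of "\<lambda>x. x * _"]
          cong: if_cong)
    then show "0 \<le> z i" using q[of "\<lambda>k. of_bool (k = i)"] by simp
  next
    fix i j assume ij: "i < n" "j < n"
    show "z (s i j) \<le> z i"
    proof (cases "s i j = i")
      case False
      then have j: "s i j = j" "s j i = j" "i \<noteq> j"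
        using assms diag unfolding selector_def by metis+
      define u where "u k = (of_bool (k = i) - of_bool (k = j) :: real)" for k
      have inner: "(\<Sum>l<n. z (s k l) * (u k * u l)) = u k * (z (s k i) - z (s k j))" for k
      proof -
        have "(\<Sum>l<n. z (s k l) * (u k * u l))
          = (\<Sum>l\<in>{i,j}. z (s k l) * (u k * u l))"
          using ij by (intro sum.mono_neutral_right) (auto simp: u_def)
        then show ?thesis using j(3) by (simp add: u_def algebra_simps)
      qed
      have "(\<Sum>k<n. u k * (z (s k i) - z (s k j))) = (\<Sum>k\<in>{i,j}. u k * (z (s k i) - z (s k j)))"
        using ij by (intro sum.mono_neutral_right) (auto simp: u_def)
      also have "\<dots> = z i - z j" using j diag by (simp add: u_def)
      finally show ?thesis using q[of u] j by (simp add: inner)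
    qed simp
  qed
next
  assume adm: "admissible s n z"
  have "z (s i j) = min (z i) (z j)" if "i < n" "j < n" for i j
  proof -
    have "z (s i j) \<le> z i" "z (s j i) \<le> z j" using adm that by (auto simp: admissible_def)
    then show ?thesis using assms unfolding selector_def by (smt (verit) min_def)
  qed
  then have "(\<Sum>i<n. \<Sum>j<n. z (s i j) * (u i * u j)) = (\<Sum>i<n. \<Sum>j<n. min (z i) (z j) * (u i * u j))" for u
    by (intro sum.cong) auto
  moreover have "0 \<le> (\<Sum>i<n. \<Sum>j<n. min (z i) (z j) * (u i * u j))" for u
    using adm by (intro min_kernel_nonneg) (auto simp: admissible_def)
  ultimately show "psd_mat (sel_mat s n z)"
    using sym_sel_mat[OF assms, of n z] unfolding psd_mat_def
    by (auto simp: scalar_prod_sel_mat[unfolded sel_mat_def] sel_mat_def)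
qed

lemma loewner_le_sel_mat_iff:
  assumes "selector s"
  shows "sel_mat s n y \<preceq>\<^sub>L sel_mat s n x \<longleftrightarrow> admissible s n (\<lambda>i. x i - y i)"
proof -
  have "sel_mat s n x - sel_mat s n y = sel_mat s n (\<lambda>i. x i - y i)"
    by (rule eq_matI) (auto simp: sel_mat_def)
  then show ?thesis
    using psd_sel_mat_iff[OF assms] sym_sel_mat[OF assms]
    by (simp add: loewner_le_def sel_mat_def)
qed

section \<open>Reduction to the scalar Jensen gap\<close>

definition gap :: "(real \<Rightarrow> real) \<Rightarrow> real \<Rightarrow> real \<Rightarrow> real \<Rightarrow> real" where
  "gap f l a b = l * f a + (1 - l) * f b - f (l * a + (1 - l) * b)"

text \<open>The two coordinates that grow are \<open>b\<close> and \<open>a - b\<close>, not \<open>a\<close> and \<open>b\<close>, because the comparison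
  \<open>B \<preceq>\<^sub>L A\<close> makes the vector of \<open>B\<close> and the difference vector of \<open>A\<close> and \<open>B\<close> monotone.\<close>

definition gap_monotone :: "(real \<Rightarrow> real) \<Rightarrow> bool" where
  "gap_monotone f \<longleftrightarrow> (\<forall>l a b a' b'. 0 \<le> l \<and> l \<le> 1 \<and> 0 \<le> b \<and> b \<le> b' \<and> 0 \<le> a - b \<and> a - b \<le> a' - b'
     \<longrightarrow> 0 \<le> gap f l a b \<and> gap f l a b \<le> gap f l a' b')"

lemma loewner_convex_on_sel_cone_iff:
  assumes "selector s"
  shows "loewner_convex_on (sel_cone s n) f \<longleftrightarrow>
    (\<forall>x y l. admissible s n x \<and> admissible s n y \<and> admissible s n (\<lambda>i. x i - y i) \<and> 0 \<le> l \<and> l \<le> 1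
      \<longrightarrow> admissible s n (\<lambda>i. gap f l (x i) (y i)))"
proof -
  have 1: "map_mat f (l \<cdot>\<^sub>m sel_mat s n x + (1 - l) \<cdot>\<^sub>m sel_mat s n y)
      = sel_mat s n (\<lambda>i. f (l * x i + (1 - l) * y i))" for l x y
    by (rule eq_matI) (auto simp: sel_mat_def)
  have 2: "l \<cdot>\<^sub>m map_mat f (sel_mat s n x) + (1 - l) \<cdot>\<^sub>m map_mat f (sel_mat s n y)
      = sel_mat s n (\<lambda>i. l * f (x i) + (1 - l) * f (y i))" for l x y
    by (rule eq_matI) (auto simp: sel_mat_def)
  have 3: "map_mat f (l \<cdot>\<^sub>m sel_mat s n x + (1 - l) \<cdot>\<^sub>m sel_mat s n y)
       \<preceq>\<^sub>L l \<cdot>\<^sub>m map_mat f (sel_mat s n x) + (1 - l) \<cdot>\<^sub>m map_mat f (sel_mat s n y)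
    \<longleftrightarrow> admissible s n (\<lambda>i. gap f l (x i) (y i))" for l x y
    unfolding 1 2 loewner_le_sel_mat_iff[OF assms] gap_def ..
  have ball: "(\<forall>A\<in>sel_cone s n. P A) \<longleftrightarrow> (\<forall>x. admissible s n x \<longrightarrow> P (sel_mat s n x))" for P
    unfolding sel_cone_def by blast
  show ?thesis
    unfolding loewner_convex_on_def ball 3 loewner_le_sel_mat_iff[OF assms]
    by (simp only: imp_conjL all_simps)
qed

lemma gap_monotone_imp_loewner_convex:
  assumes "selector s" "gap_monotone f"
  shows "loewner_convex_on (sel_cone s n) f"
  unfolding loewner_convex_on_sel_cone_iff[OF assms(1)]
proof (intro allI impI)
  fix x y :: "nat \<Rightarrow> real" and l :: real
  assume H: "admissible s n x \<and> admissible s n y \<and> admissible s n (\<lambda>i. x i - y i) \<and> 0 \<le> l \<and> l \<le> 1"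
  show "admissible s n (\<lambda>i. gap f l (x i) (y i))"
    unfolding admissible_def
  proof (intro conjI allI impI)
    fix i assume "i < n"
    then have "0 \<le> y i" "0 \<le> x i - y i" using H by (auto simp: admissible_def)
    then show "0 \<le> gap f l (x i) (y i)"
      using assms(2)[unfolded gap_monotone_def, rule_format, of l "y i" "y i" "x i" "x i"] H by simp
  next
    fix i j assume ij: "i < n" "j < n"
    have k: "0 \<le> y (s i j)" "y (s i j) \<le> y i" "0 \<le> x (s i j) - y (s i j)"
      "x (s i j) - y (s i j) \<le> x i - y i"
      using H ij selector_less[OF assms(1) ij] by (auto simp: admissible_def)
    show "gap f l (x (s i j)) (y (s i j)) \<le> gap f l (x i) (y i)"
      using assms(2)[unfolded gap_monotone_def, rule_format,
        of l "y (s i j)" "y i" "x (s i j)" "x i"] H k by simp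
  qed
qed

text \<open>The two scalar pairs are placed at the indices 0 and 1, the one with the smaller gap at \<open>s 0 1\<close>.\<close>

lemma loewner_convex_2_imp_gap_monotone:
  assumes "selector s" "loewner_convex_on (sel_cone s 2) f"
  shows "gap_monotone f"
  unfolding gap_monotone_def
proof (intro allI impI)
  fix l a b a' b' :: real
  assume H: "0 \<le> l \<and> l \<le> 1 \<and> 0 \<le> b \<and> b \<le> b' \<and> 0 \<le> a - b \<and> a - b \<le> a' - b'"
  define p where "p = s 0 1"
  have s: "s 0 0 = 0" "s 1 1 = 1" "s 1 0 = p" "s 0 1 = p" "p = 0 \<or> p = 1"
    using assms(1) unfolding selector_def p_def by metis+
  have adm: "admissible s 2 (\<lambda>i. if i = p then c else c')" if "0 \<le> c" "c \<le> c'" for c c' :: real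
  proof -
    have "i = 0 \<or> i = 1" if "i < 2" for i :: nat using that by auto
    then show ?thesis using that s unfolding admissible_def by (smt (verit))
  qed
  define x y where "x i = (if i = p then a else a')" and "y i = (if i = p then b else b')" for i
  have xy: "(\<lambda>i. x i - y i) = (\<lambda>i. if i = p then a - b else a' - b')"
    by (auto simp: x_def y_def)
  have "admissible s 2 x" "admissible s 2 y" "admissible s 2 (\<lambda>i. x i - y i)"
    unfolding xy using H by (auto simp: x_def[abs_def] y_def[abs_def] intro!: adm)
  then have D: "admissible s 2 (\<lambda>i. gap f l (x i) (y i))"
    using assms(2) H unfolding loewner_convex_on_sel_cone_iff[OF assms(1)] by blast
  have "p < 2" "1 - p < 2" "s (1 - p) p = p" "1 - p \<noteq> p" using s(3-5) by auto
  then have "0 \<le> gap f l (x p) (y p)" "gap f l (x p) (y p) \<le> gap f l (x (1 - p)) (y (1 - p))"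
    using D unfolding admissible_def by metis+
  then show "0 \<le> gap f l a b \<and> gap f l a b \<le> gap f l a' b'"
    using \<open>1 - p \<noteq> p\<close> by (simp add: x_def y_def)
qed

section \<open>Convex derivatives make the gap monotone\<close>

text \<open>The step from \<open>(a, b)\<close> to \<open>(a', b')\<close> is split into lengthening the interval at fixed \<open>b\<close>, where
  the derivative is \<open>l * (f' a - f' (l * a + (1 - l) * b))\<close>, and translating it, where the
  derivative is the Jensen gap of \<open>f'\<close>.\<close>

lemma C1_imp_gap_monotone:
  assumes C1: "C1_halfline_with_deriv f f'" and cf: "convex_on {0..} f" and cf': "convex_on {0..} f'"
  shows "gap_monotone f"
  unfolding gap_monotone_def
proof (intro allI impI)
  fix l a b a' b' :: real
  assume H: "0 \<le> l \<and> l \<le> 1 \<and> 0 \<le> b \<and> b \<le> b' \<and> 0 \<le> a - b \<and> a - b \<le> a' - b'"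
  have deriv: "(f has_real_derivative f' x) (at x)" if "x > 0" for x
  proof -
    have "(f has_real_derivative f' x) (at x within {0..})"
      using C1 that unfolding C1_halfline_with_deriv_def by auto
    moreover have "at x within {0..} = at x" using that by (intro at_within_interior) auto
    ultimately show ?thesis by simp
  qed
  have cont: "continuous_on {0..} f"
    using C1 unfolding C1_halfline_with_deriv_def continuous_on_eq_continuous_within
    using DERIV_continuous by blast
  have mono: "f' x \<le> f' y" if "0 < x" "x \<le> y" for x y
  proof -
    have "f y - f x \<ge> f' x * (y - x)" "f x - f y \<ge> f' y * (x - y)"
      using that
      by (intro convex_on_imp_above_tangent[OF cf] DERIV_subset[OF deriv]; auto)+
    then have "f' x * (y - x) \<le> f' y * (y - x)" by (simp add: algebra_simps)
    then show ?thesis using that by (cases "x = y") auto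
  qed
  define h h' where "h = a - b" and "h' = a' - b'"
  have h: "0 \<le> h" "h \<le> h'" "a = b + h" "a' = b' + h'" using H by (auto simp: h_def h'_def)
  have gap_shift: "gap f l (c + k) c = l * f (c + k) + (1 - l) * f c - f (c + l * k)" for c k
    by (simp add: gap_def algebra_simps)
  have "gap f l (b + h) b \<le> gap f l (b + h') b"
    \<comment> \<open>For \<open>l = 0\<close> the point \<open>b + l * k\<close> may stay at 0, where \<open>f\<close> is only one-sidedly differentiable.\<close>
  proof (cases "l = 0")
    case False
    show ?thesis
      unfolding gap_shift
    proof (rule DERIV_nonneg_imp_increasing_open[OF h(2)])
      fix k assume k: "h < k" "k < h'"
      have pos: "0 < b + l * k" using H h k False by (intro add_nonneg_pos) auto
      have le: "b + l * k \<le> b + k" using H h k by (simp add: mult_left_le_one_le)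
      have "((\<lambda>k. l * f (b + k) + (1 - l) * f b - f (b + l * k))
          has_real_derivative l * f' (b + k) - l * f' (b + l * k)) (at k)"
        using pos le
        by (auto intro!: derivative_eq_intros DERIV_chain2[OF deriv])
      moreover have "0 \<le> l * f' (b + k) - l * f' (b + l * k)"
        using mono[OF pos le] H by (simp add: mult_left_mono)
      ultimately show "\<exists>y. ((\<lambda>k. l * f (b + k) + (1 - l) * f b - f (b + l * k))
          has_real_derivative y) (at k) \<and> 0 \<le> y" by blast
    next
      show "continuous_on {h..h'} (\<lambda>k. l * f (b + k) + (1 - l) * f b - f (b + l * k))"
        using H h by (auto intro!: continuous_intros continuous_on_compose2[OF cont] add_nonneg_nonneg)
    qed
  qed (simp add: gap_def)
  also have "gap f l (b + h') b \<le> gap f l (b' + h') b'"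
    unfolding gap_shift
  proof (rule DERIV_nonneg_imp_increasing_open[where a = b and b = b'])
    show "b \<le> b'" using H by simp
    fix c assume c: "b < c" "c < b'"
    have c0: "0 < c" "0 < c + h'" "0 < c + l * h'"
      using c H h by (auto intro!: add_pos_nonneg)
    have "((\<lambda>c. l * f (c + h') + (1 - l) * f c - f (c + l * h'))
        has_real_derivative l * f' (c + h') + (1 - l) * f' c - f' (c + l * h')) (at c)"
      using c0 by (auto intro!: derivative_eq_intros DERIV_chain2[OF deriv] deriv)
    moreover have "f' (c + l * h') \<le> l * f' (c + h') + (1 - l) * f' c"
      using convex_onD[OF cf', of l c "c + h'"] H c0 by (simp add: algebra_simps)
    ultimately show "\<exists>y. ((\<lambda>c. l * f (c + h') + (1 - l) * f c - f (c + l * h'))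
        has_real_derivative y) (at c) \<and> 0 \<le> y" by force
  next
    show "continuous_on {b..b'} (\<lambda>c. l * f (c + h') + (1 - l) * f c - f (c + l * h'))"
      using H h by (auto intro!: continuous_intros continuous_on_compose2[OF cont] add_nonneg_nonneg
        continuous_on_subset[OF cont])
  qed
  finally have "gap f l a b \<le> gap f l a' b'" using h by simp
  moreover have "0 \<le> gap f l a b"
    using convex_onD[OF cf, of l b a] H by (simp add: gap_def algebra_simps)
  ultimately show "0 \<le> gap f l a b \<and> gap f l a b \<le> gap f l a' b'" by simp
qed

section \<open>A monotone gap forces a convex derivative\<close>

text \<open>Both one-sided difference quotients at \<open>x\<close> are squeezed between \<open>p x\<close> and \<open>p y\<close>.\<close>

lemma has_derivative_of_slope_bounds:
  fixes f p :: "real \<Rightarrow> real"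
  assumes cont: "continuous_on S p" and "x \<in> S"
    and slope: "\<And>x y. x \<in> S \<Longrightarrow> y \<in> S \<Longrightarrow> x < y \<Longrightarrow>
      p x \<le> (f y - f x) / (y - x) \<and> (f y - f x) / (y - x) \<le> p y"
  shows "(f has_real_derivative p x) (at x within S)"
  unfolding has_field_derivative_iff
proof (rule tendstoI)
  fix e :: real assume "e > 0"
  have "(p \<longlongrightarrow> p x) (at x within S)"
    using cont \<open>x \<in> S\<close> by (simp add: continuous_on_def)
  then have "\<forall>\<^sub>F y in at x within S. dist (p y) (p x) < e"
    using \<open>e > 0\<close> by (rule tendstoD)
  moreover have "\<forall>\<^sub>F y in at x within S. y \<in> S \<and> y \<noteq> x"
    by (auto simp: eventually_at_filter)
  ultimately show "\<forall>\<^sub>F y in at x within S. dist ((f y - f x) / (y - x)) (p x) < e"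
  proof eventually_elim
    case (elim y)
    have "\<bar>(f y - f x) / (y - x) - p x\<bar> \<le> \<bar>p y - p x\<bar>"
    proof (cases "x < y")
      case True
      then show ?thesis using slope[of x y] elim \<open>x \<in> S\<close> by auto
    next
      case False
      then have "p y \<le> (f x - f y) / (x - y) \<and> (f x - f y) / (x - y) \<le> p x"
        using slope[of y x] elim \<open>x \<in> S\<close> by auto
      moreover have "(f x - f y) / (x - y) = (f y - f x) / (y - x)"
        by (metis minus_diff_eq minus_divide_divide)
      ultimately show ?thesis by auto
    qed
    then show ?case using elim by (simp add: dist_real_def)
  qed
qed

text \<open>Convexity gives continuity in the interior only. At the endpoint, \<open>p\<close> lies above \<open>p 0\<close> by
  monotonicity and below the chord over \<open>[0, 1]\<close> by convexity.\<close>

lemma convex_mono_continuous_halfline: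
  fixes p :: "real \<Rightarrow> real"
  assumes cp: "convex_on {0..} p" and mono: "\<And>x y. 0 \<le> x \<Longrightarrow> x \<le> y \<Longrightarrow> p x \<le> p y"
  shows "continuous_on {0..} p"
  unfolding continuous_on_eq_continuous_within
proof
  fix x :: real assume x: "x \<in> {0..}"
  show "continuous (at x within {0..}) p"
  proof (cases "x = 0")
    case False
    have "convex_on {0<..} p"
      by (rule convex_on_subset[OF cp]) auto
    then have "continuous_on {0<..} p"
      by (rule convex_on_continuous[OF open_greaterThan])
    then have "isCont p x"
      using False x by (simp add: continuous_on_eq_continuous_at)
    then show ?thesis by (rule continuous_at_imp_continuous_at_within)
  next
    case True
    have "(p \<longlongrightarrow> p 0) (at 0 within {0..})"
    proof (rule real_tendsto_sandwich)
      show "\<forall>\<^sub>F y in at 0 within {0..}. p 0 \<le> p y"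
        using mono by (auto simp: eventually_at_filter)
      have "\<forall>\<^sub>F y in at (0::real) within {0..}. y < 1"
        by (rule order_tendstoD[OF tendsto_ident_at]) simp
      moreover have "\<forall>\<^sub>F y in at (0::real) within {0..}. 0 \<le> y"
        by (auto simp: eventually_at_filter)
      ultimately show "\<forall>\<^sub>F y in at 0 within {0..}. p y \<le> (1 - y) * p 0 + y * p 1"
      proof eventually_elim
        case (elim y)
        then show ?case using convex_onD[OF cp, of y 0 1] by simp
      qed
      have "((\<lambda>y. (1 - y) * p 0 + y * p 1) \<longlongrightarrow> (1 - 0) * p 0 + 0 * p 1) (at 0 within {0..})"
        by (intro tendsto_intros)
      then show "((\<lambda>y. (1 - y) * p 0 + y * p 1) \<longlongrightarrow> p 0) (at 0 within {0..})" by simp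
    qed simp
    then show ?thesis using True by (simp add: continuous_within)
  qed
qed

text \<open>The difference quotients must not tend to \<open>-\<infinity>\<close> at the endpoint 0, as they do for \<open>- sqrt\<close>.
  Their own convexity excludes this, since it bounds the quotient at \<open>b\<close> from below by those at
  \<open>b + 1\<close> and \<open>b + 2\<close>, which lie away from the endpoint.\<close>

lemma gap_monotone_imp_C1:
  assumes gm: "gap_monotone f"
  shows "\<exists>f'. C1_halfline_with_deriv f f' \<and> convex_on {0..} f \<and> convex_on {0..} f'"
proof -
  have gap0: "0 \<le> gap f l a b" if "0 \<le> l" "l \<le> 1" "0 \<le> b" "b \<le> a" for l a b
    using gm[unfolded gap_monotone_def, rule_format, of l b b a a] that by simp
  have gap_le: "gap f l a b \<le> gap f l (a + d) (b + d)" if "0 \<le> l" "l \<le> 1" "0 \<le> b" "b \<le> a" "0 \<le> d" for l a b d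
    using gm[unfolded gap_monotone_def, rule_format, of l b "b + d" a "a + d"] that by auto
  have cf: "convex_on {0..} f"
  proof (rule convex_onI)
    fix t x y :: real assume t: "0 < t" "t < 1" "x \<in> {0..}" "y \<in> {0..}"
    show "f ((1 - t) *\<^sub>R x + t *\<^sub>R y) \<le> (1 - t) * f x + t * f y"
      using gap0[of t x y] gap0[of "1 - t" y x] t
      by (cases "x \<le> y") (auto simp: gap_def algebra_simps)
  qed simp
  define g where "g d b = (f (b + d) - f b) / d" for d b
  have g_convex: "g d (l * a + (1 - l) * b) \<le> l * g d a + (1 - l) * g d b"
    if "0 \<le> l" "l \<le> 1" "0 \<le> b" "b \<le> a" "0 < d" for d l a b
  proof -
    have e: "l * (a + d) + (1 - l) * (b + d) = l * a + (1 - l) * b + d" by (simp add: algebra_simps)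
    have "f (l * a + (1 - l) * b + d) - f (l * a + (1 - l) * b)
       \<le> l * (f (a + d) - f a) + (1 - l) * (f (b + d) - f b)"
      using gap_le[of l b a d] that unfolding gap_def e by (simp add: algebra_simps)
    then have "(f (l * a + (1 - l) * b + d) - f (l * a + (1 - l) * b)) / d
       \<le> (l * (f (a + d) - f a) + (1 - l) * (f (b + d) - f b)) / d"
      using that(5) by (intro divide_right_mono) auto
    then show ?thesis by (simp add: g_def add_divide_distrib)
  qed
  have slope_left: "(f y - f x) / (y - x) \<le> (f z - f x) / (z - x)"
    if "0 \<le> x" "x < y" "y \<le> z" for x y z
  proof (cases "y = z")
    case False
    then have "(f x - f y) / (x - y) \<le> (f x - f z) / (x - z)"
      using convex_on_slope_le(1)[OF cf, of x z y] that by auto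
    then show ?thesis by (metis minus_diff_eq minus_divide_divide)
  qed simp
  have slope_right: "(f y - f x) / (y - x) \<le> (f z - f y) / (z - y)"
    if "0 \<le> x" "x < y" "y < z" for x y z
  proof -
    have "(f x - f y) / (x - y) \<le> (f y - f z) / (y - z)"
      using convex_on_slope_le[OF cf, of x z y] that by auto
    then show ?thesis by (metis minus_diff_eq minus_divide_divide)
  qed
  have g_mono: "g d b \<le> g e b" if "0 \<le> b" "0 < d" "d \<le> e" for d e b
    using slope_left[of b "b + d" "b + e"] that by (simp add: g_def)
  \<comment> \<open>A sequence of step sizes suffices, because the quotients are monotone in the step.\<close>
  define \<delta> where "\<delta> n = 1 / real (Suc n)" for n
  have \<delta>: "0 < \<delta> n" "\<delta> n \<le> 1" for n by (auto simp: \<delta>_def)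
  have \<delta>_mono: "\<delta> n \<le> \<delta> m" if "m \<le> n" for m n
    using that by (simp add: \<delta>_def frac_le)
  have "\<exists>L. (\<lambda>n. g (\<delta> n) b) \<longlonglongrightarrow> L \<and> (\<forall>n. L \<le> g (\<delta> n) b)" if b: "0 \<le> b" for b
  proof -
    have dec: "decseq (\<lambda>n. g (\<delta> n) b)"
      using g_mono[OF b \<delta>(1) \<delta>_mono] by (auto simp: decseq_def)
    have "2 * (f (b + 1) - f b) - g 1 (b + 2) \<le> g (\<delta> n) b" for n
    proof -
      have "2 * g (\<delta> n) (b + 1) \<le> g (\<delta> n) b + g (\<delta> n) (b + 2)"
      proof -
        have "1/2 * (b + 2) + (1 - 1/2) * b = b + 1" by (simp add: field_simps)
        then show ?thesis
          using g_convex[of "1/2" b "b + 2" "\<delta> n"] b \<delta>(1)[of n] by simp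
      qed
      moreover have "f (b + 1) - f b \<le> g (\<delta> n) (b + 1)"
        using slope_right[of b "b + 1" "b + 1 + \<delta> n"] b \<delta>(1)[of n] by (simp add: g_def)
      moreover have "g (\<delta> n) (b + 2) \<le> g 1 (b + 2)"
        using g_mono b \<delta> by simp
      ultimately show ?thesis by argo
    qed
    then show ?thesis using decseq_convergent[OF dec] by metis
  qed
  then obtain p where p_lim: "\<And>b. 0 \<le> b \<Longrightarrow> (\<lambda>n. g (\<delta> n) b) \<longlonglongrightarrow> p b"
    and p_le: "\<And>b n. 0 \<le> b \<Longrightarrow> p b \<le> g (\<delta> n) b"
    by metis
  have slope: "p x \<le> (f y - f x) / (y - x) \<and> (f y - f x) / (y - x) \<le> p y" if "0 \<le> x" "x < y" for x y
  proof
    have "0 < y - x" using that by simp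
    then obtain n where "\<delta> n < y - x"
      using reals_Archimedean[of "y - x"] by (auto simp: \<delta>_def inverse_eq_divide)
    then have "g (\<delta> n) x \<le> (f y - f x) / (y - x)"
      using slope_left[of x "x + \<delta> n" y] that \<delta>(1)[of n] by (simp add: g_def)
    then show "p x \<le> (f y - f x) / (y - x)" using p_le[OF that(1), of n] by linarith
    have "(f y - f x) / (y - x) \<le> g (\<delta> n) y" for n
      using slope_right[of x y "y + \<delta> n"] that \<delta>(1)[of n] by (simp add: g_def)
    then show "(f y - f x) / (y - x) \<le> p y"
      using that by (intro LIMSEQ_le_const[OF p_lim]) auto
  qed
  have p_mono: "p x \<le> p y" if "0 \<le> x" "x \<le> y" for x y
    using slope[of x y] that by (cases "x = y") auto
  have p_convex: "p (l * a + (1 - l) * b) \<le> l * p a + (1 - l) * p b"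
    if "0 \<le> l" "l \<le> 1" "0 \<le> b" "b \<le> a" for l a b
  proof (rule LIMSEQ_le)
    show "(\<lambda>n. g (\<delta> n) (l * a + (1 - l) * b)) \<longlonglongrightarrow> p (l * a + (1 - l) * b)"
      using that by (intro p_lim) auto
    show "(\<lambda>n. l * g (\<delta> n) a + (1 - l) * g (\<delta> n) b) \<longlonglongrightarrow> l * p a + (1 - l) * p b"
      using that by (intro tendsto_intros p_lim) auto
    show "\<exists>N. \<forall>n\<ge>N. g (\<delta> n) (l * a + (1 - l) * b) \<le> l * g (\<delta> n) a + (1 - l) * g (\<delta> n) b"
      using g_convex that \<delta> by blast
  qed
  have cp: "convex_on {0..} p"
  proof (rule convex_onI)
    fix t x y :: real assume t: "0 < t" "t < 1" "x \<in> {0..}" "y \<in> {0..}"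
    show "p ((1 - t) *\<^sub>R x + t *\<^sub>R y) \<le> (1 - t) * p x + t * p y"
      using p_convex[of t x y] p_convex[of "1 - t" y x] t
      by (cases "x \<le> y") (auto simp: algebra_simps)
  qed simp
  have cont: "continuous_on {0..} p"
    by (rule convex_mono_continuous_halfline[OF cp p_mono])
  have "C1_halfline_with_deriv f p"
    unfolding C1_halfline_with_deriv_def
    using cont slope by (auto intro!: has_derivative_of_slope_bounds)
  then show ?thesis using cf cp by blast
qed

section \<open>The concave case and the characterization\<close>

lemma loewner_concave_on_iff_convex_on_uminus:
  "loewner_concave_on C f \<longleftrightarrow> loewner_convex_on C (\<lambda>x. - f x)"
proof -
  have sym_uminus: "sym_mat (- X) \<longleftrightarrow> sym_mat X" for X
  proof -
    have "transpose_mat (- X) = - transpose_mat X" by (rule eq_matI) auto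
    moreover have "- Y = - Z \<longleftrightarrow> Y = Z" for Y Z :: "real mat"
      by (metis uminus_uminus_mat)
    ultimately show ?thesis by (simp add: sym_mat_def)
  qed
  have neg_le: "- X \<preceq>\<^sub>L - Y \<longleftrightarrow> Y \<preceq>\<^sub>L X" for X Y
  proof (cases "sym_mat X \<and> sym_mat Y \<and> dim_row X = dim_row Y")
    case True
    then have "- Y - - X = X - Y"
      by (intro eq_matI) (auto simp: sym_mat_def)
    then show ?thesis using True by (auto simp: loewner_le_def sym_uminus)
  qed (auto simp: loewner_le_def sym_uminus)
  have "map_mat (\<lambda>x. - f x) (l \<cdot>\<^sub>m A + (1 - l) \<cdot>\<^sub>m B)
        \<preceq>\<^sub>L l \<cdot>\<^sub>m map_mat (\<lambda>x. - f x) A + (1 - l) \<cdot>\<^sub>m map_mat (\<lambda>x. - f x) B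
      \<longleftrightarrow> l \<cdot>\<^sub>m map_mat f A + (1 - l) \<cdot>\<^sub>m map_mat f B \<preceq>\<^sub>L map_mat f (l \<cdot>\<^sub>m A + (1 - l) \<cdot>\<^sub>m B)"
    if "B \<preceq>\<^sub>L A" for A B l
  proof -
    have dims: "dim_row A = dim_row B" "dim_col A = dim_col B"
      using that by (auto simp: loewner_le_def sym_mat_def)
    have "map_mat (\<lambda>x. - f x) (l \<cdot>\<^sub>m A + (1 - l) \<cdot>\<^sub>m B) = - map_mat f (l \<cdot>\<^sub>m A + (1 - l) \<cdot>\<^sub>m B)"
      by (rule eq_matI) auto
    moreover have "l \<cdot>\<^sub>m map_mat (\<lambda>x. - f x) A + (1 - l) \<cdot>\<^sub>m map_mat (\<lambda>x. - f x) B
        = - (l \<cdot>\<^sub>m map_mat f A + (1 - l) \<cdot>\<^sub>m map_mat f B)"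
      using dims by (intro eq_matI) auto
    ultimately show ?thesis by (simp add: neg_le)
  qed
  then show ?thesis unfolding loewner_concave_on_def loewner_convex_on_def by blast
qed

lemma C1_halfline_uminus:
  assumes "C1_halfline_with_deriv f f'"
  shows "C1_halfline_with_deriv (\<lambda>x. - f x) (\<lambda>x. - f' x)"
  using assms unfolding C1_halfline_with_deriv_def
  by (auto intro!: derivative_intros continuous_intros)

lemma C1_concave_iff_C1_convex_uminus:
  "(\<exists>f'. C1_halfline_with_deriv f f' \<and> concave_on {0..} f \<and> concave_on {0..} f') \<longleftrightarrow>
   (\<exists>f'. C1_halfline_with_deriv (\<lambda>x. - f x) f' \<and> convex_on {0..} (\<lambda>x. - f x) \<and> convex_on {0..} f')"
proof
  assume "\<exists>f'. C1_halfline_with_deriv f f' \<and> concave_on {0..} f \<and> concave_on {0..} f'"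
  then show "\<exists>f'. C1_halfline_with_deriv (\<lambda>x. - f x) f' \<and> convex_on {0..} (\<lambda>x. - f x) \<and> convex_on {0..} f'"
    unfolding concave_on_def using C1_halfline_uminus by blast
next
  assume "\<exists>f'. C1_halfline_with_deriv (\<lambda>x. - f x) f' \<and> convex_on {0..} (\<lambda>x. - f x) \<and> convex_on {0..} f'"
  then obtain f' where f': "C1_halfline_with_deriv (\<lambda>x. - f x) f'" "convex_on {0..} (\<lambda>x. - f x)" "convex_on {0..} f'"
    by blast
  have "C1_halfline_with_deriv f (\<lambda>x. - f' x)"
    using C1_halfline_uminus[OF f'(1)] by simp
  then show "\<exists>f'. C1_halfline_with_deriv f f' \<and> concave_on {0..} f \<and> concave_on {0..} f'"
    using f' unfolding concave_on_def by (intro exI[of _ "\<lambda>x. - f' x"]) simp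
qed

text \<open>The implications run from dimension 2 to the gap condition, and from there to every dimension, so
  all the conditions coincide.\<close>

lemma loewner_convex_sel_cone_iff_C1_convex:
  assumes "selector s"
  shows "(\<forall>n\<ge>1. loewner_convex_on (sel_cone s n) f) \<longleftrightarrow>
      (\<exists>f'. C1_halfline_with_deriv f f' \<and> convex_on {0..} f \<and> convex_on {0..} f')"
    and "loewner_convex_on (sel_cone s 2) f \<longleftrightarrow>
      (\<exists>f'. C1_halfline_with_deriv f f' \<and> convex_on {0..} f \<and> convex_on {0..} f')"
proof -
  let ?Q = "\<exists>f'. C1_halfline_with_deriv f f' \<and> convex_on {0..} f \<and> convex_on {0..} f'"
  have Q: "?Q \<longleftrightarrow> gap_monotone f"
    using C1_imp_gap_monotone gap_monotone_imp_C1 by blast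
  note up = gap_monotone_imp_loewner_convex[OF assms]
    and down = loewner_convex_2_imp_gap_monotone[OF assms]
  show two: "loewner_convex_on (sel_cone s 2) f \<longleftrightarrow> ?Q"
    unfolding Q using up down by blast
  show "(\<forall>n\<ge>1. loewner_convex_on (sel_cone s n) f) \<longleftrightarrow> ?Q"
    unfolding Q using up down[of f] one_le_numeral[of "num.Bit0 num.One"] by blast
qed

theorem theorem5p7:
  fixes f :: "real \<Rightarrow> real"
  defines "convC1 \<equiv> (\<exists>f'. C1_halfline_with_deriv f f' \<and> convex_on {0..} f \<and> convex_on {0..} f')"
    and "concC1 \<equiv> (\<exists>f'. C1_halfline_with_deriv f f' \<and> concave_on {0..} f \<and> concave_on {0..} f')"
  shows
    "((\<forall>n\<ge>1. loewner_convex_on (C_min n) f) \<longleftrightarrow> convC1) \<and>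
     ((\<forall>n\<ge>1. loewner_convex_on (C_max n) f) \<longleftrightarrow> convC1) \<and>
     (loewner_convex_on (C_min 2) f \<longleftrightarrow> convC1) \<and>
     (loewner_convex_on (C_max 2) f \<longleftrightarrow> convC1) \<and>
     ((\<forall>n\<ge>1. loewner_concave_on (C_min n) f) \<longleftrightarrow> concC1) \<and>
     ((\<forall>n\<ge>1. loewner_concave_on (C_max n) f) \<longleftrightarrow> concC1) \<and>
     (loewner_concave_on (C_min 2) f \<longleftrightarrow> concC1) \<and>
     (loewner_concave_on (C_max 2) f \<longleftrightarrow> concC1)"
  unfolding convC1_def concC1_def C1_concave_iff_C1_convex_uminus
    loewner_concave_on_iff_convex_on_uminus C_min_eq_sel_cone C_max_eq_sel_cone
    loewner_convex_sel_cone_iff_C1_convex[OF selector_min]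
    loewner_convex_sel_cone_iff_C1_convex[OF selector_max]
  by simp

end
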